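(* Let $\epsilon > 0$ and let $\mathcal{A}_1$, $\mathcal{A}_2$ be two "almost dense" sequences of positive integers. Then there exist constants $0 < c < C$ (independent of $x$) such that for all sufficiently large $x$, the interval $[x, x + x^{5/9 + \epsilon}]$ contains an integer $n = m \cdot a_1 \cdot a_2$ for some $a_1 \in \mathcal{A}_1$, $a_2 \in \mathcal{A}_2$ and a positive integer $m$, with $c x^{1/3} \le a_1, a_2, m \le C x^{1/3}$.
   Context: An infinite sequence (set) $\mathcal{A}$ of positive integers is called "almost dense" if for every $\epsilon > 0$ there exists a constant $c_{\epsilon,\mathcal{A}} > 0$ such that $\#\{X \le n \le 2X : n \in \mathcal{A}\} \ge c_{\epsilon,\mathcal{A}} X^{1 - \epsilon/4}$ for all sufficiently large $X$. The notation $f \asymp g$ (used in the paper as $a_1, a_2, m \asymp x^{1/3}$) means $g \ll f \ll g$ with implied constants independent of $x$; this is rendered here via the constants $c, C$. *)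

theory Defs
  imports "HOL-Analysis.Analysis"
begin

definition almost_dense :: "nat set \<Rightarrow> bool" where
  "almost_dense A \<longleftrightarrow>
     infinite A \<and> (\<forall>n\<in>A. n > 0) \<and>
     (\<forall>\<epsilon>::real. \<epsilon> > 0 \<longrightarrow>
        (\<exists>c::real. c > 0 \<and>
           (\<forall>\<^sub>F X::real in at_top.
              real (card {n \<in> A. X \<le> real n \<and> real n \<le> 2 * X}) \<ge> c * X powr (1 - \<epsilon> / 4))))"

end

theory Submission
  imports Defs "HOL-Real_Asymp.Real_Asymp"
begin

text \<open>
  Put \<open>P = x\<^bsup>1/3\<^esup>\<close>, take \<open>a\<^sub>1, a\<^sub>2\<close> in \<open>[P, 2P]\<close> and \<open>W \<approx> P\<^bsup>2/3 + 3\<epsilon>\<^esup> / 4\<close>. It suffices that some \<open>a\<^sub>1\<close>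
  divides \<open>y + l\<close> for some \<open>l < W\<close> and some \<open>y\<close> in the set \<open>Y\<close> of the \<open>W\<close> integers following some
  \<open>x / a\<^sub>2\<close>. Otherwise, detect divisibility by additive characters modulo \<open>a\<^sub>1\<close>: the trivial character
  contributes \<open>|Y| \<Sum> W / a\<^sub>1\<close>. For each other frequency \<open>h\<close>, Cauchy-Schwarz extends the sum over \<open>Y\<close> to
  all \<open>y < 2P\<^sup>2\<close>; since the points \<open>h / a\<^sub>1\<close> are spaced by at least \<open>h / (2P)\<^sup>2\<close>, the frequency
  contributes only \<open>O(h\<^bsup>-1\<^esup> (|Y| P\<^sup>3 log P)\<^bsup>1/2\<^esup>)\<close>. Summing over \<open>h\<close> gives a contradiction as soon as \<open>W\<close>
  exceeds \<open>P\<^bsup>2/3\<^esup>\<close> by a power of \<open>P\<close> that absorbs the sparsity of the sets and the logarithms.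
\<close>

section \<open>Additive characters and geometric sums\<close>

lemma sin_ge_linear:
  fixes t :: real
  assumes "0 \<le> t" "t \<le> 1 / 2"
  shows "2 * t \<le> sin (pi * t)"
proof -
  have "concave_on {0..pi/2} sin"
    by (rule f''_le0_imp_concave[where f' = cos and f'' = "\<lambda>x. - sin x"])
       (auto intro!: derivative_eq_intros sin_ge_zero)
  from concave_onD[OF this, of "2 * t" 0 "pi / 2"] assms show ?thesis
    by (simp add: algebra_simps)
qed

text \<open>The distance equals \<open>2 * sin (pi * \<bar>t\<bar>)\<close> by the half-angle
  formula, and concavity of the sine bounds this by its chord.\<close>

lemma norm_one_minus_cis_ge:
  fixes t :: real
  assumes "\<bar>t\<bar> \<le> 1 / 2"
  shows "4 * \<bar>t\<bar> \<le> norm (1 - cis (2 * pi * t))"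
proof -
  have "(norm (1 - cis (2 * pi * t)))\<^sup>2 = (1 - cos (2 * pi * t))\<^sup>2 + (sin (2 * pi * t))\<^sup>2"
    by (simp add: cmod_power2)
  also have "\<dots> = 2 - 2 * cos (2 * pi * t)"
    using sin_cos_squared_add[of "2 * pi * t"] by (simp add: power2_eq_square algebra_simps)
  also have "\<dots> = (2 * sin (pi * \<bar>t\<bar>))\<^sup>2"
    using cos_double_sin[of "pi * t"] by (simp add: abs_if power_mult_distrib mult.assoc)
  finally have eq: "(norm (1 - cis (2 * pi * t)))\<^sup>2 = (2 * sin (pi * \<bar>t\<bar>))\<^sup>2" .
  have "4 * \<bar>t\<bar> \<le> 2 * sin (pi * \<bar>t\<bar>)"
    using sin_ge_linear[of "\<bar>t\<bar>"] assms by simp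
  moreover have "2 * sin (pi * \<bar>t\<bar>) \<le> norm (1 - cis (2 * pi * t))"
    by (rule power2_le_imp_le) (simp_all add: eq)
  ultimately show ?thesis by linarith
qed

text \<open>In the closed form of the geometric sum the numerator is at most 2 and the denominator
  at least \<open>4 * \<bar>t\<bar>\<close>, uniformly in \<open>n\<close>. For
  \<open>\<bar>t\<bar> \<le> 1 / 2\<close>, \<open>\<bar>t\<bar>\<close> is the distance from
  \<open>t\<close> to the nearest integer.\<close>

lemma norm_sum_cis_le:
  fixes t :: real
  assumes "t \<noteq> 0" "\<bar>t\<bar> \<le> 1 / 2"
  shows "norm (\<Sum>k<n. cis (2 * pi * t * real k)) \<le> 1 / (2 * \<bar>t\<bar>)"
proof -
  let ?z = "cis (2 * pi * t)"
  have ge: "4 * \<bar>t\<bar> \<le> norm (1 - ?z)" by (rule norm_one_minus_cis_ge) fact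
  with assms have "?z \<noteq> 1" by auto
  have "(\<Sum>k<n. cis (2 * pi * t * real k)) = (\<Sum>k<n. ?z ^ k)"
    by (intro sum.cong refl) (simp add: Complex.DeMoivre mult_ac)
  also have "\<dots> = (1 - ?z ^ n) / (1 - ?z)"
    using \<open>?z \<noteq> 1\<close> by (simp add: sum_gp_strict)
  also have "norm \<dots> = norm (1 - ?z ^ n) / norm (1 - ?z)"
    by (simp add: norm_divide)
  also have "\<dots> \<le> 2 / (4 * \<bar>t\<bar>)"
  proof (rule frac_le)
    show "norm (1 - ?z ^ n) \<le> 2"
      by (rule order_trans[OF norm_triangle_ineq4]) (simp add: norm_power)
  qed (use ge assms in auto)
  finally show ?thesis by simp
qed

text \<open>Orthogonality of additive characters: the ratio of this geometric sum is an
  \<open>a\<close>-th root of unity, equal to 1 exactly when \<open>a\<close> divides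
  \<open>n\<close>.\<close>

lemma sum_cis_dvd:
  fixes a n :: nat
  assumes "a > 0"
  shows "(\<Sum>h<a. cis (2 * pi * (real h * real n / real a))) = (if a dvd n then of_nat a else 0)"
proof -
  let ?z = "cis (2 * pi * (real n / real a))"
  have eq: "(\<Sum>h<a. cis (2 * pi * (real h * real n / real a))) = (\<Sum>h<a. ?z ^ h)"
    by (intro sum.cong refl) (simp add: Complex.DeMoivre mult_ac)
  show ?thesis
  proof (cases "a dvd n")
    case True
    then obtain k where "n = a * k" by (auto simp: dvd_def)
    then have "?z = 1" using assms by (simp add: cis_multiple_2pi)
    with True eq show ?thesis by simp
  next
    case False
    have "?z \<noteq> 1"
    proof
      assume "?z = 1"
      then have "cos (2 * pi * (real n / real a)) = 1" by (simp add: complex_eq_iff)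
      then obtain k :: int where "2 * pi * (real n / real a) = of_int k * 2 * pi"
        using cos_one_2pi_int by blast
      then have "real n = of_int k * real a" using assms by (simp add: field_simps)
      then have "int n = k * int a" by (metis of_int_eq_iff of_int_mult of_int_of_nat_eq)
      then show False using False by (metis dvd_triv_right int_dvd_int_iff)
    qed
    moreover have "?z ^ a = 1"
    proof -
      have "real a * (2 * pi * (real n / real a)) = 2 * pi * real n" using assms by simp
      then show ?thesis by (simp only: Complex.DeMoivre) (simp add: cis_multiple_2pi)
    qed
    ultimately show ?thesis using False eq by (simp add: sum_gp_strict)
  qed
qed

section \<open>Spacing sums and the bilinear estimate\<close>

text \<open>On each side of \<open>a\<close> the distances to the points of \<open>B\<close> are
  distinct integers in \<open>{1..M}\<close>, so each side costs at most one harmonic sum.\<close>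

lemma sum_inverse_dist_le_harm:
  fixes a M :: nat
  assumes "B \<subseteq> {..M}" "a \<le> M"
  shows "(\<Sum>b\<in>B - {a}. 1 / \<bar>real a - real b\<bar>) \<le> 2 * harm M"
proof -
  have fin: "finite B" using assms(1) finite_subset by blast
  have part: "(\<Sum>b\<in>C. 1 / \<bar>real a - real b\<bar>) \<le> harm M"
    if "finite C" "inj_on g C" "g ` C \<subseteq> {1..M}" "\<And>b. b \<in> C \<Longrightarrow> \<bar>real a - real b\<bar> = real (g b)"
    for C and g :: "nat \<Rightarrow> nat"
  proof -
    have "(\<Sum>b\<in>C. 1 / \<bar>real a - real b\<bar>) = (\<Sum>k\<in>g ` C. 1 / real k)"
      using that by (subst sum.reindex) auto
    also have "\<dots> \<le> (\<Sum>k\<in>{1..M}. 1 / real k)"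
      using that by (intro sum_mono2) auto
    finally show ?thesis by (simp add: harm_def inverse_eq_divide)
  qed
  have "(\<Sum>b\<in>B - {a}. 1 / \<bar>real a - real b\<bar>) =
      (\<Sum>b\<in>{b\<in>B. b < a}. 1 / \<bar>real a - real b\<bar>) + (\<Sum>b\<in>{b\<in>B. a < b}. 1 / \<bar>real a - real b\<bar>)"
    using fin by (subst sum.union_disjoint[symmetric]) (auto intro!: sum.cong)
  also have "\<dots> \<le> harm M + harm M"
  proof (rule add_mono)
    show "(\<Sum>b\<in>{b\<in>B. b < a}. 1 / \<bar>real a - real b\<bar>) \<le> harm M"
      by (rule part[of _ "\<lambda>b. a - b"]) (use fin assms in \<open>auto simp: inj_on_def\<close>)
    show "(\<Sum>b\<in>{b\<in>B. a < b}. 1 / \<bar>real a - real b\<bar>) \<le> harm M"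
      by (rule part[of _ "\<lambda>b. b - a"]) (use fin assms in \<open>force simp: inj_on_def\<close>)+
  qed
  finally show ?thesis by simp
qed

lemma harm_le_one_plus_ln: "n > 0 \<Longrightarrow> harm n \<le> 1 + ln (real n)"
proof -
  assume "n > 0"
  then obtain m where [simp]: "n = Suc m" by (cases n) auto
  have "harm (Suc m) - ln (real (Suc m)) \<le> harm (Suc 0) - ln (real (Suc 0))"
    by (rule decseqD[OF decseq_harm_diff_ln]) simp
  then show ?thesis by (simp add: harm_def)
qed

text \<open>A large-sieve type bound. After Cauchy-Schwarz and opening the square, the diagonal
  gives \<open>T\<close>, while a pair with \<open>a \<noteq> b\<close> gives a geometric sum of
  frequency \<open>h / a - h / b\<close>, whose inverse is summed over \<open>b\<close>
  harmonically. The condition \<open>2 * h \<le> a\<close> keeps every \<open>h / a\<close> in (0,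
  1/2], so the differences do not wrap around modulo 1.\<close>

lemma bilinear_cis_bound:
  fixes \<alpha> :: "nat \<Rightarrow> complex" and K :: real and h M T :: nat
  assumes h: "h > 0" and B: "B \<subseteq> {2 * h..M}" and Y: "Y \<subseteq> {..<T}"
    and \<alpha>: "\<And>a. a \<in> B \<Longrightarrow> norm (\<alpha> a) \<le> K"
  shows "(norm (\<Sum>y\<in>Y. \<Sum>a\<in>B. \<alpha> a * cis (2 * pi * (real h * real y / real a))))\<^sup>2
           \<le> real (card Y) * (K\<^sup>2 * real (card B) * (real T + (real M)\<^sup>2 * harm M))"
proof -
  define f where "f y = (\<Sum>a\<in>B. \<alpha> a * cis (2 * pi * (real h * real y / real a)))" for y :: nat
  define t where "t a b = real h / real a - real h / real b" for a b :: nat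
  have finB: "finite B" and finY: "finite Y" using B Y finite_subset by blast+
  have pair: "norm (\<Sum>y<T. cis (2 * pi * t a b * real y)) \<le> (real M)\<^sup>2 / 2 * (1 / \<bar>real a - real b\<bar>)"
    if ab: "a \<in> B" "b \<in> B - {a}" for a b
  proof -
    have pos: "a > 0" "b > 0" "2 * real h \<le> real a" "2 * real h \<le> real b" "a \<le> M" "b \<le> M" "a \<noteq> b"
      using ab B h by auto
    have ha: "0 < real h / real a" "real h / real a \<le> 1 / 2" "0 < real h / real b" "real h / real b \<le> 1 / 2"
      using pos h by (auto simp: field_simps)
    have eq: "\<bar>t a b\<bar> = real h * \<bar>real a - real b\<bar> / (real a * real b)"
    proof -
      have "t a b = real h * (real b - real a) / (real a * real b)"
        using pos by (simp add: t_def field_simps)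
      then show ?thesis by (simp add: abs_mult abs_divide abs_minus_commute)
    qed
    have "\<bar>t a b\<bar> \<le> 1 / 2" using ha unfolding t_def by linarith
    moreover have "t a b \<noteq> 0" using eq pos h by auto
    ultimately have "norm (\<Sum>y<T. cis (2 * pi * t a b * real y)) \<le> 1 / (2 * \<bar>t a b\<bar>)"
      by (intro norm_sum_cis_le)
    also have "\<dots> = (real a * real b) / (2 * (real h * \<bar>real a - real b\<bar>))"
      by (simp add: eq)
    \<comment> \<open>Here \<open>h\<close> in the spacing is replaced by 1; the decay in
      \<open>h\<close> will come from \<open>K\<close> instead.\<close>
    also have "\<dots> \<le> (real M)\<^sup>2 / (2 * (1 * \<bar>real a - real b\<bar>))"
      using pos h by (intro frac_le mult_left_mono mult_right_mono)
        (auto simp: power2_eq_square intro!: mult_mono)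
    finally show ?thesis by simp
  qed
  have sq: "(\<Sum>y<T. (norm (f y))\<^sup>2) \<le> K\<^sup>2 * real (card B) * (real T + (real M)\<^sup>2 * harm M)"
  proof -
    have "complex_of_real (\<Sum>y<T. (norm (f y))\<^sup>2) = (\<Sum>y<T. f y * cnj (f y))"
      by (simp add: complex_norm_square del: of_real_power)
    also have "\<dots> = (\<Sum>y<T. \<Sum>a\<in>B. \<Sum>b\<in>B. \<alpha> a * cnj (\<alpha> b) * cis (2 * pi * t a b * real y))"
      unfolding f_def cnj_sum sum_product
      by (intro sum.cong refl)
        (simp add: t_def cis_cnj cis_mult mult_ac ring_distribs diff_divide_distrib)
    also have "\<dots> = (\<Sum>a\<in>B. \<Sum>b\<in>B. \<alpha> a * cnj (\<alpha> b) * (\<Sum>y<T. cis (2 * pi * t a b * real y)))"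
      unfolding sum_distrib_left by (subst sum.swap, intro sum.cong refl sum.swap)
    finally have eq: "complex_of_real (\<Sum>y<T. (norm (f y))\<^sup>2) = \<dots>" .
    \<comment> \<open>The expanded double sum is complex, but it equals a nonnegative real, so its
      norm loses nothing.\<close>
    have "(\<Sum>y<T. (norm (f y))\<^sup>2) = norm (complex_of_real (\<Sum>y<T. (norm (f y))\<^sup>2))"
      by (simp only: norm_of_real) (simp add: sum_nonneg)
    also have "\<dots> \<le> (\<Sum>a\<in>B. \<Sum>b\<in>B. norm (\<alpha> a * cnj (\<alpha> b) * (\<Sum>y<T. cis (2 * pi * t a b * real y))))"
      unfolding eq by (intro order_trans[OF norm_sum] sum_mono norm_sum)
    also have "\<dots> \<le> (\<Sum>a\<in>B. \<Sum>b\<in>B. K\<^sup>2 * norm (\<Sum>y<T. cis (2 * pi * t a b * real y)))"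
    proof (intro sum_mono)
      fix a b assume "a \<in> B" "b \<in> B"
      then have "norm (\<alpha> a) * norm (\<alpha> b) \<le> K * K"
        by (intro mult_mono \<alpha>) (auto intro: order_trans[OF norm_ge_zero \<alpha>])
      then show "norm (\<alpha> a * cnj (\<alpha> b) * (\<Sum>y<T. cis (2 * pi * t a b * real y)))
          \<le> K\<^sup>2 * norm (\<Sum>y<T. cis (2 * pi * t a b * real y))"
        by (simp add: norm_mult power2_eq_square mult_right_mono)
    qed
    also have "\<dots> \<le> (\<Sum>a\<in>B. K\<^sup>2 * (real T + (real M)\<^sup>2 * harm M))"
    proof (intro sum_mono)
      fix a assume a: "a \<in> B"
      have "(\<Sum>b\<in>B. norm (\<Sum>y<T. cis (2 * pi * t a b * real y)))
          = norm (\<Sum>y<T. cis (2 * pi * t a a * real y))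
            + (\<Sum>b\<in>B - {a}. norm (\<Sum>y<T. cis (2 * pi * t a b * real y)))"
        by (rule sum.remove) (use finB a in auto)
      also have "\<dots> \<le> real T + (\<Sum>b\<in>B - {a}. (real M)\<^sup>2 / 2 * (1 / \<bar>real a - real b\<bar>))"
        by (intro add_mono sum_mono pair a) (simp_all add: t_def)
      also have "\<dots> \<le> real T + (real M)\<^sup>2 / 2 * (2 * harm M)"
        unfolding sum_distrib_left[symmetric]
        by (intro add_left_mono mult_left_mono sum_inverse_dist_le_harm) (use a B in auto)
      finally show "(\<Sum>b\<in>B. K\<^sup>2 * norm (\<Sum>y<T. cis (2 * pi * t a b * real y)))
          \<le> K\<^sup>2 * (real T + (real M)\<^sup>2 * harm M)"
        unfolding sum_distrib_left[symmetric] by (intro mult_left_mono) auto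
    qed
    finally show ?thesis by (simp add: mult_ac)
  qed
  \<comment> \<open>Cauchy-Schwarz over \<open>Y\<close>, then completion to all
    \<open>y < T\<close>, which only adds nonnegative terms.\<close>
  have "(norm (\<Sum>y\<in>Y. f y))\<^sup>2 \<le> (\<Sum>y\<in>Y. norm (f y))\<^sup>2"
    by (intro power_mono norm_sum) auto
  also have "\<dots> \<le> (\<Sum>y\<in>Y. (norm (f y))\<^sup>2) * real (card Y)"
    by (rule sum_squared_le_sum_of_squares)
  also have "\<dots> \<le> (\<Sum>y<T. (norm (f y))\<^sup>2) * real (card Y)"
    by (intro mult_right_mono sum_mono2) (use Y in auto)
  also have "\<dots> \<le> (K\<^sup>2 * real (card B) * (real T + (real M)\<^sup>2 * harm M)) * real (card Y)"
    by (intro mult_right_mono sq) auto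
  finally show ?thesis by (simp add: f_def mult_ac)
qed

section \<open>Sifting by additive characters\<close>

text \<open>Frequencies \<open>h\<close> and \<open>a - h\<close> are conjugate, so the upper half
  of the residues folds onto the lower half, where \<open>2 * h \<le> a\<close> as the bilinear
  bound requires. The self-paired \<open>h = a / 2\<close> must count once, whence one weak and one
  strict inequality. The range \<open>{1..M}\<close> does not depend on \<open>a\<close>, which
  prepares the interchange of the sums over \<open>a\<close> and \<open>h\<close>.\<close>

lemma sum_cis_symmetric_residues:
  fixes a n M :: nat
  assumes a: "0 < a" "a \<le> M"
  defines "e \<equiv> \<lambda>h. cis (2 * pi * (real h * real n / real a))"
  shows "(\<Sum>h<a. e h) = 1 + (\<Sum>h | h \<in> {1..M} \<and> 2 * h \<le> a. e h)
           + cnj (\<Sum>h | h \<in> {1..M} \<and> 2 * h < a. e h)"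
proof -
  let ?L = "{h. h \<in> {1..M} \<and> 2 * h \<le> a}" and ?U = "{h. h < a \<and> a < 2 * h}"
    and ?V = "{h. h \<in> {1..M} \<and> 2 * h < a}"
  have "e (a - k) = cnj (e k)" if "k < a" for k
  proof -
    have "2 * pi * (real (a - k) * real n / real a) = 2 * pi * real n - 2 * pi * (real k * real n / real a)"
      using a that by (simp add: of_nat_diff field_simps)
    then have "e (a - k) = cis (2 * pi * real n) * cis (- (2 * pi * (real k * real n / real a)))"
      unfolding e_def by (simp only: cis_mult) simp
    then show ?thesis by (simp add: e_def cis_cnj cis_multiple_2pi)
  qed
  then have "(\<Sum>h\<in>?U. e h) = (\<Sum>k\<in>?V. cnj (e k))"
    using a by (intro sum.reindex_bij_witness[of _ "\<lambda>k. a - k" "\<lambda>h. a - h"]) auto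
  moreover have "{..<a} = insert 0 (?L \<union> ?U)" using a by auto
  moreover have "(\<Sum>h\<in>insert 0 (?L \<union> ?U). e h) = e 0 + ((\<Sum>h\<in>?L. e h) + (\<Sum>h\<in>?U. e h))"
    by (subst sum.insert) (auto intro!: sum.union_disjoint)
  moreover have "e 0 = 1" by (simp add: e_def)
  ultimately show ?thesis by (simp add: cnj_sum add.assoc)
qed

text \<open>If no \<open>a\<close> divides any \<open>y + l\<close>, the total character sum
  vanishes, so the trivial frequency must be cancelled by the others. Its contribution is at least
  \<open>card Y * card A * W / M\<close>; the others contribute at most \<open>R * harm M\<close>.
  Squaring the comparison gives the claim.\<close>

lemma sifted_bound:
  fixes A Y :: "nat set" and M T W :: nat
  assumes A: "A \<subseteq> {1..M}" and Y: "Y \<subseteq> {..<T}"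
    and sifted: "\<And>a y l. a \<in> A \<Longrightarrow> y \<in> Y \<Longrightarrow> l < W \<Longrightarrow> \<not> a dvd y + l"
  shows "real (card Y) * real (card A) * (real W)\<^sup>2
           \<le> (real M)\<^sup>2 * (harm M)\<^sup>2 * (real T + (real M)\<^sup>2 * harm M)"
proof -
  define e where "e a h n = cis (2 * pi * (real h * real n / real a))" for a h n :: nat
  \<comment> \<open>The whole sum over \<open>l\<close> is absorbed into a coefficient free of
    \<open>y\<close>; being geometric, it has norm at most \<open>1 / (2 * h)\<close> after division
    by \<open>a\<close>.\<close>
  define \<beta> where "\<beta> a h = (\<Sum>l<W. e a h l) / of_nat a" for a h :: nat
  define S where "S h B = (\<Sum>y\<in>Y. \<Sum>a\<in>B. \<beta> a h * e a h y)" for h B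
  define Q where "Q = real T + (real M)\<^sup>2 * harm M"
  define R where "R = sqrt (real (card Y) * real (card A) * Q)"
  have finA: "finite A" and finY: "finite Y" using A Y finite_subset by blast+
  have Q: "Q \<ge> 0" by (simp add: Q_def harm_nonneg)
  have e_add: "e a h (y + l) = e a h l * e a h y" for a h y l
    by (simp add: e_def cis_mult ring_distribs add_divide_distrib add.commute)

  have expansion: "0 = of_nat W / of_nat a + (\<Sum>h | h \<in> {1..M} \<and> 2 * h \<le> a. \<beta> a h * e a h y)
      + cnj (\<Sum>h | h \<in> {1..M} \<and> 2 * h < a. \<beta> a h * e a h y)" if "a \<in> A" "y \<in> Y" for a y
  proof -
    have a: "0 < a" "a \<le> M" using that A by auto
    have coefficient: "(\<Sum>l<W. \<Sum>h\<in>H. e a h (y + l)) / of_nat a = (\<Sum>h\<in>H. \<beta> a h * e a h y)" for H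
      by (subst sum.swap) (simp add: \<beta>_def e_add sum_divide_distrib sum_distrib_right)
    have "(\<Sum>h<a. e a h (y + l)) = 0" if "l < W" for l
      using sum_cis_dvd[OF a(1), of "y + l"] sifted[OF \<open>a \<in> A\<close> \<open>y \<in> Y\<close> that] by (simp add: e_def)
    then have "0 = (\<Sum>l<W. \<Sum>h<a. e a h (y + l)) / of_nat a" by simp
    also have "\<dots> = (\<Sum>l<W. 1 + (\<Sum>h | h \<in> {1..M} \<and> 2 * h \<le> a. e a h (y + l))
        + cnj (\<Sum>h | h \<in> {1..M} \<and> 2 * h < a. e a h (y + l))) / of_nat a"
      unfolding e_def by (subst sum_cis_symmetric_residues[OF a]) (rule refl)
    also have "\<dots> = of_nat W / of_nat a
        + (\<Sum>l<W. \<Sum>h | h \<in> {1..M} \<and> 2 * h \<le> a. e a h (y + l)) / of_nat a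
        + cnj ((\<Sum>l<W. \<Sum>h | h \<in> {1..M} \<and> 2 * h < a. e a h (y + l)) / of_nat a)"
      by (simp add: sum.distrib add_divide_distrib)
    finally show ?thesis unfolding coefficient .
  qed

  have S_bound: "norm (S h B) \<le> R * (1 / (2 * real h))" if h: "h > 0" and B: "B \<subseteq> {a \<in> A. 2 * h \<le> a}" for h B
  proof -
    have \<beta>: "norm (\<beta> a h) \<le> 1 / (2 * real h)" if "a \<in> B" for a
    proof -
      have a: "a > 0" "2 * h \<le> a" using that B A by auto
      have "\<bar>real h / real a\<bar> \<le> 1 / 2" using a by (simp add: field_simps)
      then have "norm (\<Sum>l<W. cis (2 * pi * (real h / real a) * real l)) \<le> 1 / (2 * \<bar>real h / real a\<bar>)"
        using h a by (intro norm_sum_cis_le) auto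
      then have "norm (\<Sum>l<W. e a h l) \<le> real a / (2 * real h)" by (simp add: e_def mult_ac)
      then show ?thesis using a h by (simp add: \<beta>_def norm_divide field_simps)
    qed
    have "B \<subseteq> {2 * h..M}" using B A by fastforce
    from bilinear_cis_bound[OF h this Y \<beta>]
    have "(norm (S h B))\<^sup>2 \<le> real (card Y) * ((1 / (2 * real h))\<^sup>2 * real (card B) * Q)"
      by (simp add: S_def e_def Q_def)
    also have "\<dots> \<le> real (card Y) * ((1 / (2 * real h))\<^sup>2 * real (card A) * Q)"
    proof (intro mult_left_mono mult_right_mono Q)
      show "real (card B) \<le> real (card A)" using B finA by (auto intro!: card_mono)
    qed auto
    also have "\<dots> = (R * (1 / (2 * real h)))\<^sup>2"
      unfolding power_mult_distrib R_def using Q by (simp add: mult_ac)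
    finally show ?thesis
      by (rule power2_le_imp_le) (simp add: R_def Q)
  qed

  \<comment> \<open>The range of \<open>h\<close> depends on \<open>a\<close>, so after the
    interchange each frequency keeps only the \<open>a\<close> that admit it.\<close>
  have swap: "(\<Sum>y\<in>Y. \<Sum>a\<in>A. \<Sum>h | h \<in> {1..M} \<and> P h a. \<beta> a h * e a h y)
      = (\<Sum>h=1..M. S h {a \<in> A. P h a})" for P :: "nat \<Rightarrow> nat \<Rightarrow> bool"
  proof -
    have "(\<Sum>y\<in>Y. \<Sum>a\<in>A. \<Sum>h | h \<in> {1..M} \<and> P h a. \<beta> a h * e a h y)
        = (\<Sum>y\<in>Y. \<Sum>h=1..M. \<Sum>a | a \<in> A \<and> P h a. \<beta> a h * e a h y)"
      by (intro sum.cong refl sum.swap_restrict finA) auto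
    also have "\<dots> = (\<Sum>h=1..M. S h {a \<in> A. P h a})"
      unfolding S_def by (rule sum.swap)
    finally show ?thesis .
  qed
  have "0 = (\<Sum>y\<in>Y. \<Sum>a\<in>A. of_nat W / of_nat a
      + (\<Sum>h | h \<in> {1..M} \<and> 2 * h \<le> a. \<beta> a h * e a h y)
      + cnj (\<Sum>h | h \<in> {1..M} \<and> 2 * h < a. \<beta> a h * e a h y))"
    by (intro sum.neutral[symmetric] ballI sum.neutral expansion[symmetric])
  also have "\<dots> = of_nat (card Y) * (\<Sum>a\<in>A. of_nat W / of_nat a)
      + (\<Sum>h=1..M. S h {a \<in> A. 2 * h \<le> a}) + cnj (\<Sum>h=1..M. S h {a \<in> A. 2 * h < a})"
    unfolding swap[symmetric] by (simp add: sum.distrib cnj_sum del: complex_cnj_mult)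
  finally have main: "of_nat (card Y) * (\<Sum>a\<in>A. of_nat W / of_nat a)
      = - ((\<Sum>h=1..M. S h {a \<in> A. 2 * h \<le> a}) + cnj (\<Sum>h=1..M. S h {a \<in> A. 2 * h < a}))"
    unfolding add.assoc by (rule eq_neg_iff_add_eq_0[THEN iffD2, OF sym])

  have half: "norm (\<Sum>h=1..M. S h (B h)) \<le> R * harm M / 2" if "\<And>h. B h \<subseteq> {a \<in> A. 2 * h \<le> a}" for B
  proof -
    have "norm (\<Sum>h=1..M. S h (B h)) \<le> (\<Sum>h=1..M. R * (1 / (2 * real h)))"
      by (intro order_trans[OF norm_sum] sum_mono S_bound that) auto
    also have "\<dots> = R * harm M / 2"
      by (simp add: harm_def sum_distrib_left sum_divide_distrib field_simps)
    finally show ?thesis .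
  qed
  have "real (card Y) * (\<Sum>a\<in>A. real W / real a)
      = norm (complex_of_real (real (card Y) * (\<Sum>a\<in>A. real W / real a)))"
    by (simp only: norm_of_real) (simp add: sum_nonneg)
  also have "complex_of_real (real (card Y) * (\<Sum>a\<in>A. real W / real a))
      = of_nat (card Y) * (\<Sum>a\<in>A. of_nat W / of_nat a)" by simp
  also have "norm \<dots> \<le> R * harm M / 2 + R * harm M / 2"
    unfolding main norm_minus_cancel
    by (rule norm_triangle_mono[OF half]) (auto simp only: complex_mod_cnj intro!: half)
  finally have upper: "real (card Y) * (\<Sum>a\<in>A. real W / real a) \<le> R * harm M" by simp
  have "(\<Sum>a\<in>A. real W / real M) \<le> (\<Sum>a\<in>A. real W / real a)"
    using A by (intro sum_mono divide_left_mono) (auto intro!: mult_pos_pos)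
  from mult_left_mono[OF this, of "real (card Y)"]
  have "real (card Y) * (real (card A) * real W / real M) \<le> R * harm M"
    using upper by simp
  then have "real (card Y) * real (card A) * real W \<le> R * harm M * real M"
    by (cases "M = 0") (use A in \<open>auto simp: field_simps\<close>)
  then have "(real (card Y) * real (card A) * real W)\<^sup>2 \<le> (R * harm M * real M)\<^sup>2"
    by (intro power_mono) auto
  also have "\<dots> = real (card Y) * real (card A) * ((real M)\<^sup>2 * (harm M)\<^sup>2 * Q)"
    using Q by (simp add: R_def power_mult_distrib)
  \<comment> \<open>One factor \<open>card Y * card A\<close> cancels; if it is zero, the claim has
    left side zero.\<close>
  finally have "(real (card Y) * real (card A)) * (real (card Y) * real (card A) * (real W)\<^sup>2)
      \<le> (real (card Y) * real (card A)) * ((real M)\<^sup>2 * (harm M)\<^sup>2 * Q)"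
    by (simp add: power2_eq_square mult_ac)
  then show ?thesis
    using Q unfolding Q_def
    by (cases "real (card Y) * real (card A) = 0") (auto simp: mult_le_cancel_left)
qed

section \<open>Products near a cube for a fixed scale \<open>P\<close>\<close>

text \<open>If \<open>a1 * m = u a2 + j + l\<close> with \<open>j, l < W\<close>, then
  \<open>a1 * m\<close> is within \<open>2 * W\<close> of \<open>P ^ 3 / a2\<close>, and multiplying
  by \<open>a2 \<le> 2 * P\<close> gives the error \<open>4 * P * W\<close>. Hypothesis
  \<open>large\<close> contradicts \<open>sifted_bound\<close>; the third power of \<open>W\<close>
  arises because \<open>Y\<close> itself has \<open>card A2 * W\<close> elements.\<close>

lemma product_near_cube:
  fixes P :: real and A1 A2 :: "nat set" and W :: nat
  assumes P: "P \<ge> 2" and W: "real W + 1 \<le> P / 4"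
    and A1: "A1 \<subseteq> {n. P \<le> real n \<and> real n \<le> 2 * P}"
    and A2: "A2 \<subseteq> {n. P \<le> real n \<and> real n \<le> 2 * P}"
    and large: "(2 * P)\<^sup>2 * (1 + ln (2 * P))\<^sup>2 * (2 * P\<^sup>2 + (2 * P)\<^sup>2 * (1 + ln (2 * P)))
                  < real (card A1) * real (card A2) * real W ^ 3"
  shows "\<exists>m a1 a2. a1 \<in> A1 \<and> a2 \<in> A2 \<and> real (m * a1 * a2) \<in> {P ^ 3..P ^ 3 + 4 * P * real W}
           \<and> real m \<in> {P / 4..2 * P}"
proof -
  define x where "x = P ^ 3"
  define u where "u a = nat \<lceil>x / real a\<rceil>" for a
  define Y where "Y = (\<lambda>(a, j). u a + j) ` (A2 \<times> {..<W})"
  define M where "M = nat \<lfloor>2 * P\<rfloor>"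
  define T where "T = nat \<lfloor>2 * P\<^sup>2\<rfloor>"
  have x: "x > 0" using P by (simp add: x_def)
  have M: "real M \<le> 2 * P" "M > 0" using P by (auto simp: M_def)
  have T: "real T \<le> 2 * P\<^sup>2" "2 * P\<^sup>2 - 1 < real T" using P unfolding T_def by (simp_all add: of_nat_nat)
  have u: "x / real a \<le> real (u a)" "real (u a) < x / real a + 1" for a
  proof -
    have "0 \<le> x / real a" using x by simp
    then show "x / real a \<le> real (u a)" "real (u a) < x / real a + 1" unfolding u_def by linarith+
  qed
  have A1_bounds: "P \<le> real a" "real a \<le> 2 * P" "a > 0" if "a \<in> A1" for a
    using A1 P that by (force intro!: Nat.gr0I)+
  have A2_bounds: "P \<le> real a" "real a \<le> 2 * P" "a > 0" if "a \<in> A2" for a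
    using A2 P that by (force intro!: Nat.gr0I)+

  \<comment> \<open>Distinct points \<open>x / a\<close> are at least
    \<open>P ^ 3 / (2 * P) ^ 2 = P / 4\<close> apart, which covers the block length \<open>W\<close>
    plus the rounding of the ceiling, so the blocks are disjoint.\<close>
  have u_gap: "u b + W < u a" if "a \<in> A2" "b \<in> A2" "a < b" for a b
  proof -
    have "P / 4 = x * 1 / ((2 * P) * (2 * P))"
      using P by (simp add: x_def field_simps power3_eq_cube)
    also have "\<dots> \<le> x * (real b - real a) / (real a * real b)"
      using A2_bounds[OF that(1)] A2_bounds[OF that(2)] that(3) x
      by (intro frac_le mult_left_mono mult_mono) auto
    also have "\<dots> = x / real a - x / real b"
      using A2_bounds[OF that(1)] A2_bounds[OF that(2)] by (simp add: field_simps)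
    finally have "real (u b) + real W < real (u a)" using u(1)[of a] u(2)[of b] W by linarith
    then show ?thesis by linarith
  qed
  have "inj_on (\<lambda>(a, j). u a + j) (A2 \<times> {..<W})"
  proof (rule inj_onI, clarify)
    fix a j b i assume *: "a \<in> A2" "b \<in> A2" "j < W" "i < W" "u a + j = u b + i"
    then have "a = b" using u_gap[of a b] u_gap[of b a] by (cases a b rule: linorder_cases) auto
    with * show "a = b \<and> j = i" by simp
  qed
  then have card_Y: "card Y = card A2 * W"
    by (simp add: Y_def card_image card_cartesian_product)

  have "\<exists>a\<in>A1. \<exists>y\<in>Y. \<exists>l<W. a dvd y + l"
  proof (rule ccontr)
    assume none: "\<not> ?thesis"
    have "A1 \<subseteq> {1..M}"
    proof
      fix a assume "a \<in> A1"
      then have "1 \<le> a" "real a \<le> 2 * P" using A1_bounds[of a] by auto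
      then show "a \<in> {1..M}" by (auto simp: M_def le_nat_iff le_floor_iff)
    qed
    moreover have "Y \<subseteq> {..<T}"
    proof
      fix y assume "y \<in> Y"
      then obtain a j where aj: "a \<in> A2" "j < W" "y = u a + j" by (auto simp: Y_def)
      \<comment> \<open>Blocks start below \<open>P\<^sup>2 + 1\<close>, so the cutoff
        \<open>T\<close> of about twice \<open>P\<^sup>2\<close> contains them entirely.\<close>
      have "x / real a \<le> x / P" using A2_bounds[OF aj(1)] P x by (intro divide_left_mono) auto
      also have "\<dots> = P\<^sup>2" using P by (simp add: x_def power2_eq_square power3_eq_cube)
      finally have "real y < P\<^sup>2 + P / 4" using u(2)[of a] aj W by simp
      moreover have "2 * P \<le> P\<^sup>2" using P by (simp add: power2_eq_square)
      ultimately have "real y < real T" using T P by linarith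
      then show "y \<in> {..<T}" by simp
    qed
    ultimately have "real (card Y) * real (card A1) * (real W)\<^sup>2
        \<le> (real M)\<^sup>2 * (harm M)\<^sup>2 * (real T + (real M)\<^sup>2 * harm M)"
      using none by (intro sifted_bound) auto
    moreover have "\<dots> \<le> (2 * P)\<^sup>2 * (1 + ln (2 * P))\<^sup>2 * (2 * P\<^sup>2 + (2 * P)\<^sup>2 * (1 + ln (2 * P)))"
    proof -
      have "ln (real M) \<le> ln (2 * P)" using M P by (subst ln_le_cancel_iff) auto
      then have "harm M \<le> 1 + ln (2 * P)" using harm_le_one_plus_ln[OF M(2)] by linarith
      moreover have "0 \<le> (harm M :: real)" by (rule harm_nonneg)
      ultimately show ?thesis
        using M T P by (intro mult_mono add_mono power_mono) auto
    qed
    ultimately show False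
      using large by (simp add: card_Y power2_eq_square power3_eq_cube mult_ac)
  qed
  then obtain a1 a2 j l where a: "a1 \<in> A1" "a2 \<in> A2" and jl: "j < W" "l < W" and "a1 dvd u a2 + j + l"
    by (auto simp: Y_def)
  then obtain m where m: "u a2 + j + l = a1 * m" by (auto simp: dvd_def)
  note b1 = A1_bounds[OF a(1)] and b2 = A2_bounds[OF a(2)]
  have n: "real (m * a1 * a2) = (real (u a2) + real j + real l) * real a2"
    using arg_cong[OF m, of real] by (simp add: mult_ac)
  have "x = x / real a2 * real a2" using b2 by simp
  also have "\<dots> \<le> (real (u a2) + real j + real l) * real a2"
    using u(1)[of a2] by (intro mult_right_mono) auto
  finally have lower: "x \<le> real (m * a1 * a2)" unfolding n .
  \<comment> \<open>Since \<open>j\<close> and \<open>l\<close> are at most \<open>W - 1\<close>,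
    the bound \<open>2 * W\<close> also absorbs the rounding error of \<open>u\<close>.\<close>
  have "(real (u a2) + real j + real l) * real a2 \<le> (x / real a2 + 2 * real W) * real a2"
    using u(2)[of a2] jl by (intro mult_right_mono) auto
  also have "\<dots> = x + 2 * real W * real a2" using b2 by (simp add: field_simps)
  also have "\<dots> \<le> x + 2 * real W * (2 * P)" using b2 by (intro add_left_mono mult_left_mono) auto
  finally have upper: "real (m * a1 * a2) \<le> x + 4 * P * real W" unfolding n by (simp add: mult_ac)
  have "P / 4 \<le> real m"
  proof -
    have "x \<le> real m * (real a1 * real a2)" using lower by (simp add: mult_ac)
    also have "\<dots> \<le> real m * ((2 * P) * (2 * P))"
      using b1 b2 P by (intro mult_left_mono mult_mono) auto
    finally have "P * P\<^sup>2 \<le> 4 * real m * P\<^sup>2"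
      by (simp add: x_def power2_eq_square power3_eq_cube mult_ac)
    then show ?thesis using P by simp
  qed
  moreover have "real m \<le> 2 * P"
  proof -
    have "real m * P\<^sup>2 \<le> real m * (real a1 * real a2)"
      using b1 b2 P unfolding power2_eq_square by (intro mult_left_mono mult_mono) auto
    also have "\<dots> \<le> x + 4 * P * real W" using upper by (simp add: mult_ac)
    \<comment> \<open>The excess is at most \<open>P\<^sup>2\<close>, hence at most
      \<open>P ^ 3\<close>.\<close>
    also have "\<dots> \<le> x + 4 * P * (P / 4)" using P W by (intro add_left_mono mult_left_mono) auto
    also have "\<dots> \<le> 2 * P * P\<^sup>2"
      using P by (simp add: x_def power2_eq_square power3_eq_cube)
    finally show ?thesis using P by simp
  qed
  ultimately show ?thesis using a lower upper by (auto simp: x_def)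
qed

section \<open>Choice of parameters and passage to the limit\<close>

text \<open>The sifting bound has order \<open>P ^ 4\<close> times the cube of a logarithm. Against
  it stand two densities and three factors \<open>W\<close>, of total exponent \<open>2 * (1 -
  \<epsilon>) + 3 * (2 / 3 + 3 * \<epsilon>) = 4 + 7 * \<epsilon>\<close>. The cap on
  \<open>\<epsilon>\<close> keeps the exponent of \<open>W\<close> at most 5/6, so that blocks stay
  shorter than their spacing.\<close>

lemma product_near_cube_almost_dense:
  fixes \<epsilon> :: real and A1 A2 :: "nat set"
  assumes \<epsilon>: "0 < \<epsilon>" "\<epsilon> \<le> 1 / 18"
    and "almost_dense A1" "almost_dense A2"
  shows "\<forall>\<^sub>F P::real in at_top. \<exists>m a1 a2. a1 \<in> A1 \<and> a2 \<in> A2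
           \<and> real (m * a1 * a2) \<in> {P ^ 3..P ^ 3 + P powr (5 / 3 + 3 * \<epsilon>)}
           \<and> real a1 \<in> {P..2 * P} \<and> real a2 \<in> {P..2 * P} \<and> real m \<in> {P / 4..2 * P}"
proof -
  \<comment> \<open>Density is taken at \<open>4 * \<epsilon>\<close> to cancel the division by 4 in
    its definition.\<close>
  have dense: "\<exists>c>0. \<forall>\<^sub>F P in at_top. real (card {n \<in> A. P \<le> real n \<and> real n \<le> 2 * P}) \<ge> c * P powr (1 - \<epsilon>)"
    if "almost_dense A" for A
  proof -
    have "\<exists>c>0. \<forall>\<^sub>F P in at_top. real (card {n \<in> A. P \<le> real n \<and> real n \<le> 2 * P}) \<ge> c * P powr (1 - (4 * \<epsilon>) / 4)"
      using that \<epsilon>(1) unfolding almost_dense_def by (elim conjE allE[of _ "4 * \<epsilon>"]) simp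
    then show ?thesis by simp
  qed
  obtain c1 c2 :: real where c: "c1 > 0" "c2 > 0"
    and "\<forall>\<^sub>F P in at_top. real (card {n \<in> A1. P \<le> real n \<and> real n \<le> 2 * P}) \<ge> c1 * P powr (1 - \<epsilon>)"
      "\<forall>\<^sub>F P in at_top. real (card {n \<in> A2. P \<le> real n \<and> real n \<le> 2 * P}) \<ge> c2 * P powr (1 - \<epsilon>)"
    using dense[OF assms(3)] dense[OF assms(4)] by blast
  note counts = this(3,4)
  define w where "w P = P powr (2 / 3 + 3 * \<epsilon>)" for P :: real
  have "\<forall>\<^sub>F P::real in at_top. P \<ge> 2" by (rule eventually_ge_at_top)
  moreover have "\<forall>\<^sub>F P in at_top. w P \<ge> 8"
    unfolding w_def using \<epsilon> by real_asymp
  moreover have "\<forall>\<^sub>F P in at_top. w P / 4 + 1 \<le> P / 4"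
    unfolding w_def using \<epsilon> by real_asymp
  moreover have "\<forall>\<^sub>F P::real in at_top.
      (2 * P)\<^sup>2 * (1 + ln (2 * P))\<^sup>2 * (2 * P\<^sup>2 + (2 * P)\<^sup>2 * (1 + ln (2 * P)))
      < (c1 * P powr (1 - \<epsilon>)) * (c2 * P powr (1 - \<epsilon>)) * (w P / 8) ^ 3"
    unfolding w_def using \<epsilon> c by real_asymp
  ultimately show ?thesis using counts
  proof eventually_elim
    case (elim P)
    \<comment> \<open>The divisor 4 compensates the factor in \<open>4 * P * W\<close>;
      \<open>w P \<ge> 8\<close> ensures that rounding down at most halves
      \<open>w P / 4\<close>.\<close>
    define W where "W = nat \<lfloor>w P / 4\<rfloor>"
    define B1 where "B1 = {n \<in> A1. P \<le> real n \<and> real n \<le> 2 * P}"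
    define B2 where "B2 = {n \<in> A2. P \<le> real n \<and> real n \<le> 2 * P}"
    have W: "real W \<le> w P / 4" "w P / 8 \<le> real W" using elim(2) unfolding W_def by linarith+
    note elim(4)
    also have "(c1 * P powr (1 - \<epsilon>)) * (c2 * P powr (1 - \<epsilon>)) * (w P / 8) ^ 3
        \<le> real (card B1) * real (card B2) * real W ^ 3"
      using elim(2,5,6) c W unfolding B1_def B2_def by (intro mult_mono power_mono) auto
    finally have "\<exists>m a1 a2. a1 \<in> B1 \<and> a2 \<in> B2 \<and> real (m * a1 * a2) \<in> {P ^ 3..P ^ 3 + 4 * P * real W}
           \<and> real m \<in> {P / 4..2 * P}"
      using elim(1,3) W by (intro product_near_cube) (auto simp: B1_def B2_def)
    moreover have "4 * P * real W \<le> P powr (5 / 3 + 3 * \<epsilon>)"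
    proof -
      have "4 * P * real W \<le> P * w P" using W elim(1) by simp
      also have "\<dots> = P powr (1 + (2 / 3 + 3 * \<epsilon>))"
        unfolding w_def powr_add using elim(1) by simp
      finally show ?thesis by (simp add: add.assoc[symmetric])
    qed
    ultimately show ?case unfolding B1_def B2_def by fastforce
  qed
qed

theorem theorem1:
  fixes \<epsilon> :: real and A1 A2 :: "nat set"
  assumes "\<epsilon> > 0"
    and "almost_dense A1"
    and "almost_dense A2"
  shows "\<exists>c C :: real. 0 < c \<and> c < C \<and>
           (\<forall>\<^sub>F x::real in at_top.
              \<exists>n m a1 a2 :: nat.
                a1 \<in> A1 \<and> a2 \<in> A2 \<and> m > 0 \<and> n = m * a1 * a2 \<and>
                real n \<in> {x .. x + x powr (5 / 9 + \<epsilon>)} \<and>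
                real a1 \<in> {c * x powr (1 / 3) .. C * x powr (1 / 3)} \<and>
                real a2 \<in> {c * x powr (1 / 3) .. C * x powr (1 / 3)} \<and>
                real m \<in> {c * x powr (1 / 3) .. C * x powr (1 / 3)})"
proof -
  \<comment> \<open>A smaller exponent only shortens the interval once \<open>x \<ge> 1\<close>, so
    large \<open>\<epsilon>\<close> reduces to the capped value.\<close>
  define \<delta> where "\<delta> = min \<epsilon> (1 / 18)"
  have \<delta>: "0 < \<delta>" "\<delta> \<le> 1 / 18" "\<delta> \<le> \<epsilon>" using assms(1) by (auto simp: \<delta>_def)
  have root: "filterlim (\<lambda>x::real. x powr (1 / 3)) at_top at_top" by real_asymp
  have "\<forall>\<^sub>F x::real in at_top.
              \<exists>n m a1 a2 :: nat.
                a1 \<in> A1 \<and> a2 \<in> A2 \<and> m > 0 \<and> n = m * a1 * a2 \<and>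
                real n \<in> {x .. x + x powr (5 / 9 + \<epsilon>)} \<and>
                real a1 \<in> {1 / 4 * x powr (1 / 3) .. 2 * x powr (1 / 3)} \<and>
                real a2 \<in> {1 / 4 * x powr (1 / 3) .. 2 * x powr (1 / 3)} \<and>
                real m \<in> {1 / 4 * x powr (1 / 3) .. 2 * x powr (1 / 3)}"
    using eventually_compose_filterlim[OF product_near_cube_almost_dense[OF \<delta>(1,2) assms(2,3)] root]
      eventually_ge_at_top[of 1]
  proof eventually_elim
    case (elim x)
    define P where "P = x powr (1 / 3)"
    have P: "P > 0" using elim(2) by (simp add: P_def)
    have cube: "P ^ 3 = x" using elim(2) by (simp add: P_def powr_power)
    have "P powr (5 / 3 + 3 * \<delta>) = x powr (5 / 9 + \<delta>)"
      by (simp add: P_def powr_powr field_simps)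
    also have "\<dots> \<le> x powr (5 / 9 + \<epsilon>)" using elim(2) \<delta> by (intro powr_mono) auto
    finally have len: "P powr (5 / 3 + 3 * \<delta>) \<le> x powr (5 / 9 + \<epsilon>)" .
    from elim(1) obtain m a1 a2 where "a1 \<in> A1" "a2 \<in> A2"
      and n: "real (m * a1 * a2) \<in> {P ^ 3..P ^ 3 + P powr (5 / 3 + 3 * \<delta>)}"
      and b: "real a1 \<in> {P..2 * P}" "real a2 \<in> {P..2 * P}" "real m \<in> {P / 4..2 * P}"
      unfolding P_def by blast
    moreover have "m > 0" using b P by (intro Nat.gr0I) auto
    moreover have "real (m * a1 * a2) \<in> {x..x + x powr (5 / 9 + \<epsilon>)}"
      using n len unfolding cube by simp
    moreover have "real a1 \<in> {1 / 4 * P..2 * P}" "real a2 \<in> {1 / 4 * P..2 * P}" "real m \<in> {1 / 4 * P..2 * P}"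
      using b P by auto
    ultimately show ?case unfolding P_def by blast
  qed
  \<comment> \<open>The lower constant 1/4 is dictated by \<open>m\<close>, while 2 bounds all three
    factors.\<close>
  then show ?thesis by (intro exI[of _ "1 / 4"] exI[of _ 2]) simp
qed

end
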